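(* Let $R$ be a commutative domain, $n\ge1$, and $\phi$ an $R$-algebra automorphism of the Dirac quantum (Weyl) algebra $A_n(R)$. Then $\deg(\phi^{-1})\le \deg(\phi)^{2n-1}$.
   Context: $A_n(R)$ is the associative $R$-algebra generated by $Y_1,\ldots,Y_{2n}$ with relations $[Y_i,Y_{j+n}]=\delta_{ij}$, $[Y_i,Y_j]=0$, $[Y_{i+n},Y_{j+n}]=0$ for $1\le i,j\le n$. It is a free $R$-module with basis the ordered monomials $Y_1^{a_1}\cdots Y_{2n}^{a_{2n}}$; for nonzero $a\in A_n(R)$, $\deg(a)$ is the maximal total degree $a_1+\cdots+a_{2n}$ of a monomial occurring in $a$ with nonzero coefficient. For a nonzero endomorphism $\phi$, $\deg(\phi)=\max_{1\le i\le 2n}\deg(\phi(Y_i))$. *)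

theory Defs
  imports Main "HOL-Library.Poly_Mapping"
begin

(* Model of the Weyl algebra A_n(R).  An ordered monomial
  Y_1^{a_1} ... Y_{2n}^{a_{2n}} is encoded by its exponent vector
  m :: nat =>0 nat with Poly_Mapping.lookup m j = a_{j+1} (0-based indices, Poly_Mapping.keys m \<subseteq> {..<2n}).
  An element of A_n(R) is a finitely supported coefficient function
  (nat =>0 nat) =>0 R on ordered monomials (the R-basis).
  The generator Y_{j+1} (0-based j) is weyl_gen j.  Relation: for i < n,
  Y_i Y_{i+n} - Y_{i+n} Y_i = 1, i.e. the first n generators act as
  derivations d_i and the last n as variables x_i, with d_i x_i - x_i d_i = 1,
  and normal order puts d's left of x's. *)

type_synonym 'a weyl = "(nat \<Rightarrow>\<^sub>0 nat) \<Rightarrow>\<^sub>0 'a"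

definition weyl_carrier :: "nat \<Rightarrow> 'a::comm_ring_1 weyl set" where
  "weyl_carrier n = {p. \<forall>m \<in> Poly_Mapping.keys p. Poly_Mapping.keys m \<subseteq> {..<2*n}}"

definition weyl_gen :: "nat \<Rightarrow> 'a::comm_ring_1 weyl" where
  "weyl_gen j = Poly_Mapping.single (Poly_Mapping.single j 1) 1"

definition weyl_one :: "'a::comm_ring_1 weyl" where
  "weyl_one = Poly_Mapping.single 0 1"

definition weyl_smult :: "'a::comm_ring_1 \<Rightarrow> 'a weyl \<Rightarrow> 'a weyl" where
  "weyl_smult r p = Poly_Mapping.map (\<lambda>c. r * c) p"

(* Normal ordering rule (per index i, independently):
  x^b d^c = \<Sum>_k (-1)^k k! C(b,k) C(c,k) d^{c-k} x^{b-k}.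
  Product of basis monomials a and b (times scalar c), with k ranging over
  vectors k :: nat \<Rightarrow> nat supported on {..<n} with k i \<le> min (x-exp of a at i)
  (d-exp of b at i). *)
definition weyl_contr_set :: "nat \<Rightarrow> (nat \<Rightarrow>\<^sub>0 nat) \<Rightarrow> (nat \<Rightarrow>\<^sub>0 nat) \<Rightarrow> (nat \<Rightarrow> nat) set" where
  "weyl_contr_set n a b =
     {k. (\<forall>i. n \<le> i \<longrightarrow> k i = 0) \<and>
         (\<forall>i<n. k i \<le> min (Poly_Mapping.lookup a (n + i)) (Poly_Mapping.lookup b i))}"

definition weyl_contr_coeff :: "nat \<Rightarrow> (nat \<Rightarrow>\<^sub>0 nat) \<Rightarrow> (nat \<Rightarrow>\<^sub>0 nat) \<Rightarrow> (nat \<Rightarrow> nat) \<Rightarrow> int" where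
  "weyl_contr_coeff n a b k =
     (\<Prod>i<n. (-1) ^ k i * fact (k i) * int (Poly_Mapping.lookup a (n + i) choose k i)
                                      * int (Poly_Mapping.lookup b i choose k i))"

definition weyl_contr_mono :: "nat \<Rightarrow> (nat \<Rightarrow>\<^sub>0 nat) \<Rightarrow> (nat \<Rightarrow>\<^sub>0 nat) \<Rightarrow> (nat \<Rightarrow> nat) \<Rightarrow> (nat \<Rightarrow>\<^sub>0 nat)" where
  "weyl_contr_mono n a b k =
     a + b - (\<Sum>i<n. Poly_Mapping.single i (k i) + Poly_Mapping.single (n + i) (k i))"

definition weyl_mono_mult :: "nat \<Rightarrow> 'a::comm_ring_1 \<Rightarrow> (nat \<Rightarrow>\<^sub>0 nat) \<Rightarrow> (nat \<Rightarrow>\<^sub>0 nat) \<Rightarrow> 'a weyl" where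
  "weyl_mono_mult n c a b =
     (\<Sum>k \<in> weyl_contr_set n a b.
        Poly_Mapping.single (weyl_contr_mono n a b k) (c * of_int (weyl_contr_coeff n a b k)))"

definition weyl_mult :: "nat \<Rightarrow> 'a::comm_ring_1 weyl \<Rightarrow> 'a weyl \<Rightarrow> 'a weyl" where
  "weyl_mult n p q =
     (\<Sum>a \<in> Poly_Mapping.keys p. \<Sum>b \<in> Poly_Mapping.keys q. weyl_mono_mult n (Poly_Mapping.lookup p a * Poly_Mapping.lookup q b) a b)"

definition weyl_deg :: "'a::comm_ring_1 weyl \<Rightarrow> nat" where
  "weyl_deg p = Max ((\<lambda>m. sum (Poly_Mapping.lookup m) (Poly_Mapping.keys m)) ` Poly_Mapping.keys p)"

definition weyl_map_deg :: "nat \<Rightarrow> ('a::comm_ring_1 weyl \<Rightarrow> 'a weyl) \<Rightarrow> nat" where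
  "weyl_map_deg n \<phi> = Max ((\<lambda>j. weyl_deg (\<phi> (weyl_gen j))) ` {..<2*n})"

definition weyl_automorphism :: "nat \<Rightarrow> ('a::comm_ring_1 weyl \<Rightarrow> 'a weyl) \<Rightarrow> bool" where
  "weyl_automorphism n \<phi> \<longleftrightarrow>
     bij_betw \<phi> (weyl_carrier n) (weyl_carrier n) \<and>
     (\<forall>p \<in> weyl_carrier n. \<forall>q \<in> weyl_carrier n. \<phi> (p + q) = \<phi> p + \<phi> q) \<and>
     (\<forall>r. \<forall>p \<in> weyl_carrier n. \<phi> (weyl_smult r p) = weyl_smult r (\<phi> p)) \<and>
     (\<forall>p \<in> weyl_carrier n. \<forall>q \<in> weyl_carrier n. \<phi> (weyl_mult n p q) = weyl_mult n (\<phi> p) (\<phi> q)) \<and>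
     \<phi> weyl_one = weyl_one"

end

theory Submission
  imports Defs Complex_Main
begin

text \<open>Write \<open>N = 2n\<close>, \<open>d = deg \<phi>\<close>, let \<open>G\<close> be the preimage of a generator \<open>Y\<^sub>j\<close>, of degree \<open>D\<close>, and let
  \<open>F\<^sub>k\<close> be the span of the monomials of degree at most \<open>k\<close>. As degrees add under multiplication,
  the image of \<open>F\<^sub>k\<close> in \<open>A/AG\<close> has rank about \<open>D k^(N-1) / (N-1)!\<close>. Since \<open>\<phi>\<close> embeds it into the image
  of \<open>F\<^sub>d\<^sub>k\<close> in \<open>A/AY\<^sub>j\<close>, whose rank is about \<open>(d k)^(N-1) / (N-1)!\<close>, letting \<open>k\<close> tend to infinity gives
  \<open>D \<le> d^(N-1)\<close>. Concretely, \<open>A/AG\<close> is represented by the monomials not divisible by the leading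
  monomial of \<open>G\<close>, and right ideals replace left ideals when \<open>j\<close> is a derivation index.\<close>

section \<open>Total degree of exponent vectors\<close>

definition monom_deg :: "('b \<Rightarrow>\<^sub>0 nat) \<Rightarrow> nat" where
  "monom_deg m = sum (Poly_Mapping.lookup m) (Poly_Mapping.keys m)"

lemma monom_deg_eq_sum:
  assumes "finite A" "Poly_Mapping.keys m \<subseteq> A"
  shows "monom_deg m = sum (Poly_Mapping.lookup m) A"
  unfolding monom_deg_def using assms
  by (intro sum.mono_neutral_left) (auto simp: in_keys_iff)

lemma monom_deg_zero [simp]: "monom_deg 0 = 0"
  by (simp add: monom_deg_def)

lemma monom_deg_single [simp]: "monom_deg (Poly_Mapping.single j c) = c"
  by (simp add: monom_deg_def)

lemma monom_deg_add: "monom_deg (a + b) = monom_deg a + monom_deg b"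
proof -
  let ?A = "Poly_Mapping.keys a \<union> Poly_Mapping.keys b"
  have "monom_deg (a + b) = sum (Poly_Mapping.lookup (a + b)) ?A"
    by (intro monom_deg_eq_sum Poly_Mapping.keys_add) simp
  also have "\<dots> = sum (Poly_Mapping.lookup a) ?A + sum (Poly_Mapping.lookup b) ?A"
    by (simp add: lookup_add sum.distrib)
  finally show ?thesis
    by (simp add: monom_deg_eq_sum[of ?A])
qed

section \<open>Linear dependence over a domain\<close>

text \<open>Fraction-free Gaussian elimination: a pivot row clears one column, and induction applies
  to the remaining rows and columns. Avoiding division lets the argument run over a domain, where it
  replaces a comparison of ranks.\<close>

lemma exists_nontrivial_relation:
  fixes f :: "'s \<Rightarrow> 't \<Rightarrow> 'a::idom"
  assumes "finite T" "finite S" "card T < card S"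
  shows "\<exists>c. (\<exists>s\<in>S. c s \<noteq> 0) \<and> (\<forall>t\<in>T. (\<Sum>s\<in>S. c s * f s t) =
      0)"
  using assms
proof (induction T arbitrary: S f rule: finite_induct)
  case empty
  then show ?case by (intro exI[of _ "\<lambda>_. 1"]) (auto simp: card_gt_0_iff)
next
  case (insert t T)
  show ?case
  proof (cases "\<forall>s\<in>S. f s t = 0")
    case True
    have "card T < card S" using insert by simp
    from insert.IH[OF insert.prems(1) this, of f] True show ?thesis
      by auto
  next
    case False
    then obtain s0 where s0: "s0 \<in> S" "f s0 t \<noteq> 0" by blast
    let ?S = "S - {s0}"
    have "card T < card ?S" using insert s0 by simp
    from insert.IH[OF _ this, of "\<lambda>s u. f s0 t * f s u - f s t * f s0 u"] insert.prems(1)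
    obtain c where c: "\<exists>s\<in>?S. c s \<noteq> 0"
      "\<forall>u\<in>T. (\<Sum>s\<in>?S. c s * (f s0 t * f s u - f s t * f s0 u)) = 0"
      by auto
    \<comment> \<open>Column \<open>t\<close> dictates the coefficient of the pivot row
      \<open>s0\<close>. The others are scaled by the nonzero pivot entry, so a nonzero one stays
      nonzero in a domain.\<close>
    define c' where "c' = (\<lambda>s. if s = s0 then - (\<Sum>s\<in>?S. c s * f s t) else c s * f s0 t)"
    have split: "(\<Sum>s\<in>S. c' s * f s u) =
        (\<Sum>s\<in>?S. c s * (f s0 t * f s u - f s t * f s0 u))" for u
    proof -
      have "(\<Sum>s\<in>S. c' s * f s u) = c' s0 * f s0 u + (\<Sum>s\<in>?S. c' s * f s u)"
        using insert.prems(1) s0 by (simp add: sum.remove)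
      also have "(\<Sum>s\<in>?S. c' s * f s u) = (\<Sum>s\<in>?S. c s * f s0 t * f s u)"
        by (rule sum.cong) (auto simp: c'_def)
      also have "c' s0 * f s0 u = - (\<Sum>s\<in>?S. c s * f s t * f s0 u)"
        by (simp add: c'_def sum_distrib_right)
      finally show ?thesis
        by (simp add: algebra_simps sum_subtractf)
    qed
    show ?thesis
    proof (intro exI conjI ballI)
      show "\<exists>s\<in>S. c' s \<noteq> 0"
        using c(1) s0 by (auto simp: c'_def)
      fix u assume "u \<in> insert t T"
      then show "(\<Sum>s\<in>S. c' s * f s u) = 0"
        unfolding split using c(2) by (auto simp: mult.commute)
    qed
  qed
qed

section \<open>Counting monomials and comparing growth\<close>

text \<open>With \<open>A = {..<2 * n}\<close> this indexes a basis of the elements of degree at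
  most \<open>k\<close>. Other index sets are allowed because removing \<open>j\<close> leaves the
  monomials that survive modulo the one-sided ideal of the generator
  \<open>weyl_gen j\<close>.\<close>

definition monoms :: "'b set \<Rightarrow> nat \<Rightarrow> ('b \<Rightarrow>\<^sub>0 nat) set" where
  "monoms A k = {m. Poly_Mapping.keys m \<subseteq> A \<and> monom_deg m \<le> k}"

lemma monoms_insert:
  assumes "x \<notin> A"
  shows "monoms (insert x A) k = (\<Union>t\<in>{..k}. (+) (Poly_Mapping.single x t) ` monoms A (k - t))"
    (is "?L = ?R")
proof (intro set_eqI iffI)
  fix m assume m: "m \<in> ?L"
  define t where "t = Poly_Mapping.lookup m x"
  define m' where "m' = m - Poly_Mapping.single x t"
  have eq: "m = Poly_Mapping.single x t + m'"
    by (rule poly_mapping_eqI) (auto simp: m'_def t_def lookup_add lookup_minus lookup_single when_def)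
  have "Poly_Mapping.keys m' \<subseteq> A"
  proof
    fix y assume "y \<in> Poly_Mapping.keys m'"
    then have "Poly_Mapping.lookup m' y \<noteq> 0" by (simp add: in_keys_iff)
    then have "y \<noteq> x" "Poly_Mapping.lookup m y \<noteq> 0"
      by (auto simp: m'_def t_def lookup_minus lookup_single when_def split: if_splits)
    moreover from this have "y \<in> Poly_Mapping.keys m" by (simp add: in_keys_iff)
    ultimately show "y \<in> A" using m by (auto simp: monoms_def)
  qed
  moreover have "t + monom_deg m' \<le> k"
    using m unfolding monoms_def by (subst (asm) eq) (simp add: monom_deg_add)
  ultimately show "m \<in> ?R"
    unfolding eq by (intro UN_I[of t] imageI) (auto simp: monoms_def)
next
  fix m assume "m \<in> ?R"
  then obtain t m' where "t \<le> k" "m' \<in> monoms A (k - t)" "m = Poly_Mapping.single x t + m'" by auto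
  then show "m \<in> ?L"
    using Poly_Mapping.keys_add[of "Poly_Mapping.single x t" m']
    by (auto simp: monoms_def monom_deg_add split: if_splits)
qed

text \<open>Sorting by the exponent of a new index gives a disjoint union, whose pieces add up by
  the hockey-stick identity. Finiteness shares the induction because counting the union needs finite
  pieces.\<close>

lemma finite_monoms_and_card:
  assumes "finite A"
  shows "finite (monoms A k) \<and> card (monoms A k) = (k + card A) choose card A"
  using assms
proof (induction A arbitrary: k rule: finite_induct)
  case empty
  have "monoms ({} :: 'a set) k = {0}" by (auto simp: monoms_def)
  then show ?case by simp
next
  case (insert x A)
  let ?f = "\<lambda>t. (+) (Poly_Mapping.single x t) ` monoms A (k - t)"
  have at_x: "Poly_Mapping.lookup m x = t" if "m \<in> ?f t" for m t
    using that insert.hyps by (auto simp: lookup_add monoms_def in_keys_iff)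
  have disj: "?f t \<inter> ?f u = {}" if "t \<noteq> u" for t u
  proof (rule Int_emptyI)
    fix m assume "m \<in> ?f t" "m \<in> ?f u"
    then show False using at_x[of m t] at_x[of m u] that by simp
  qed
  have "card (monoms (insert x A) k) = (\<Sum>t\<le>k. card (?f t))"
    unfolding monoms_insert[OF insert.hyps(2)]
    by (rule card_UN_disjoint) (use insert.IH disj in auto)
  also have "\<dots> = (\<Sum>t\<le>k. (k - t + card A) choose card A)"
    using insert.IH by (intro sum.cong refl) (simp add: card_image)
  \<comment> \<open>The summation is reversed, \<open>t\<close> becoming \<open>k - t\<close>, to
    reach the form of the hockey-stick identity.\<close>
  also have "\<dots> = (\<Sum>t\<le>k. (card A + t) choose card A)"
    by (rule sum.reindex_bij_witness[of _ "\<lambda>t. k - t" "\<lambda>t. k - t"]) (auto simp: add.commute)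
  also have "\<dots> = (k + Suc (card A)) choose Suc (card A)"
    using choose_rising_sum(1)[where n="card A" and m=k] by (simp add: ac_simps)
  finally show ?case
    using insert by (simp add: monoms_insert)
qed

lemmas finite_monoms = finite_monoms_and_card[THEN conjunct1]
  and card_monoms = finite_monoms_and_card[THEN conjunct2]

text \<open>The right-hand side is the product (k+1)...(k+r), each factor of which is at least
  k.\<close>

lemma power_le_fact_binomial: "k ^ r \<le> fact r * ((k + r) choose r)"
proof (induction r)
  case (Suc r)
  have "k ^ Suc r \<le> (k + Suc r) * (fact r * ((k + r) choose r))"
    using Suc by (simp only: power_Suc) (intro mult_mono, auto)
  also have "\<dots> = fact r * (Suc r * ((k + Suc r) choose Suc r))"
    using Suc_times_binomial_eq[of "k + r" r] by (simp add: algebra_simps)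
  also have "\<dots> = fact (Suc r) * ((k + Suc r) choose Suc r)"
    by (simp add: algebra_simps)
  finally show ?case .
qed simp

text \<open>By Pascal's rule, raising \<open>D\<close> by one adds a binomial coefficient that is at
  least \<open>(k + Suc r) choose r\<close>. The gap counts the monomials not divisible by a fixed
  monomial of degree \<open>D\<close>.\<close>

lemma binomial_gap:
  "D * ((k + Suc r) choose r) + ((k + Suc r) choose Suc r) \<le> (k + D + Suc r) choose Suc r"
proof (induction D)
  case (Suc D)
  have "((k + Suc r) choose r) \<le> (k + D + Suc r) choose r"
    by (rule binomial_right_mono) auto
  then show ?case using Suc by simp
qed simp

text \<open>Both sides of the hypothesis are polynomials in \<open>k\<close> of degree at most
  \<open>r\<close>; their coefficients at k^r are D/r! and d^r/r!. Clearing r!, dividing by k^r and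
  passing to the limit compares these.\<close>

lemma le_power_of_binomial_growth:
  assumes le: "\<And>k. D * ((k + r) choose r) \<le> (d * (k + D) + r) choose r"
  shows "D \<le> d ^ r"
proof -
  have *: "D * k ^ r \<le> (d * (k + D) + r) ^ r" for k
  proof -
    have "D * k ^ r \<le> D * (fact r * ((k + r) choose r))"
      by (intro mult_left_mono power_le_fact_binomial) simp
    also have "\<dots> = fact r * (D * ((k + r) choose r))" by simp
    also have "\<dots> \<le> fact r * ((d * (k + D) + r) choose r)"
      by (intro mult_left_mono le) simp
    also have "\<dots> \<le> (d * (k + D) + r) ^ r"
      using binomial_fact_pow[of "d * (k + D) + r" r] by (simp add: mult.commute)
    finally show ?thesis .
  qed
  \<comment> \<open>The bound is used at \<open>Suc k\<close>, so that the division is by a positive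
    number.\<close>
  have "real D \<le> (real d + real (d * D + r) / real (Suc k)) ^ r" for k
  proof -
    have "real D * real (Suc k) ^ r \<le> (real d * (real (Suc k) + real D) + real r) ^ r"
      using *[of "Suc k"] unfolding of_nat_mult[symmetric] of_nat_power[symmetric] of_nat_add[symmetric]
      by (simp only: of_nat_le_iff)
    then have "real D \<le> (real d * (real (Suc k) + real D) + real r) ^ r / real (Suc k) ^ r"
      by (simp add: field_simps)
    also have "\<dots> = (real d + real (d * D + r) / real (Suc k)) ^ r"
      unfolding power_divide[symmetric] by (simp add: field_simps)
    finally show ?thesis .
  qed
  moreover have "(\<lambda>k. (real d + real (d * D + r) / real (Suc k)) ^ r) \<longlonglongrightarrow> (real d + 0) ^ r"
    by (intro tendsto_intros LIMSEQ_Suc[OF lim_const_over_n])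
  ultimately have "real D \<le> real d ^ r"
    by (intro LIMSEQ_le_const[of _ "real d ^ r"]) auto
  then show ?thesis by (simp flip: of_nat_power)
qed

section \<open>Normal-ordered products\<close>

lemma zero_in_weyl_contr_set: "(\<lambda>_. 0) \<in> weyl_contr_set n a b"
  by (simp add: weyl_contr_set_def)

lemma finite_weyl_contr_set: "finite (weyl_contr_set n a b)"
proof (rule finite_subset)
  let ?B = "\<Union>i<n. {..Poly_Mapping.lookup a (n + i)}"
  show "weyl_contr_set n a b \<subseteq>
      {k :: nat \<Rightarrow> nat. \<forall>i. (i \<in> {..<n} \<longrightarrow> k i \<in> ?B) \<and> (i \<notin> {..<n} \<longrightarrow> k i = 0)}"
    by (auto simp: weyl_contr_set_def)
  show "finite {k :: nat \<Rightarrow> nat. \<forall>i. (i \<in> {..<n} \<longrightarrow> k i \<in> ?B) \<and> (i \<notin> {..<n} \<longrightarrow> k i = 0)}"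
    by (rule finite_set_of_finite_funs) auto
qed

lemma weyl_contr_mono_zero: "weyl_contr_mono n a b (\<lambda>_. 0) = a + b"
  by (simp add: weyl_contr_mono_def)

lemma weyl_contr_coeff_zero: "weyl_contr_coeff n a b (\<lambda>_. 0) = 1"
  by (simp add: weyl_contr_coeff_def)

lemma keys_weyl_contr_mono: "Poly_Mapping.keys (weyl_contr_mono n a b k)
    \<subseteq> Poly_Mapping.keys a \<union> Poly_Mapping.keys b"
  by (auto simp: weyl_contr_mono_def in_keys_iff lookup_minus lookup_add)

lemma monom_deg_sum: "monom_deg (sum f A) = (\<Sum>x\<in>A. monom_deg (f x))"
  by (induction A rule: infinite_finite_induct) (auto simp: monom_deg_add)

text \<open>Each contraction cancels one variable against one derivation and so costs two degrees.
  Hence only the term without contraction reaches the full degree.\<close>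

lemma monom_deg_weyl_contr_mono:
  assumes "k \<in> weyl_contr_set n a b"
  shows "monom_deg (weyl_contr_mono n a b k) + 2 * sum k {..<n} = monom_deg (a + b)"
proof -
  define s where "s = (\<Sum>i<n. Poly_Mapping.single i (k i) + Poly_Mapping.single (n + i) (k i))"
  \<comment> \<open>Subtraction of exponents truncates at zero; this bound shows that here it is
    exact.\<close>
  have le: "Poly_Mapping.lookup s j \<le> Poly_Mapping.lookup (a + b) j" for j
  proof -
    have "Poly_Mapping.lookup s j = (\<Sum>i<n. (k i when i = j)) + (\<Sum>i<n. (k i when n + i = j))"
      by (simp add: s_def lookup_sum lookup_add lookup_single sum.distrib)
    also have "(\<Sum>i<n. (k i when i = j)) = (if j < n then k j else 0)"
      by (simp add: when_def)
    also have "(\<Sum>i<n. (k i when n + i = j)) =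
        (\<Sum>i<n. if i = j - n then if n \<le> j then k i else 0 else 0)"
      by (rule sum.cong) (auto simp: when_def)
    also have "\<dots> = (if n \<le> j \<and> j < 2 * n then k (j - n) else 0)"
      by auto
    also have "(if j < n then k j else 0) + \<dots> \<le> Poly_Mapping.lookup (a + b) j"
    proof -
      have "k j \<le> Poly_Mapping.lookup b j" if "j < n"
        using assms that by (auto simp: weyl_contr_set_def)
      moreover have "k (j - n) \<le> Poly_Mapping.lookup a j" if "n \<le> j" "j < 2 * n"
      proof -
        have "j - n < n" using that by auto
        then have "k (j - n) \<le> Poly_Mapping.lookup a (n + (j - n))"
          using assms by (auto simp: weyl_contr_set_def)
        then show ?thesis using that by simp
      qed
      ultimately show ?thesis by (auto simp: lookup_add intro: trans_le_add1 trans_le_add2)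
    qed
    finally show ?thesis .
  qed
  have "weyl_contr_mono n a b k + s = a + b"
  proof (rule poly_mapping_eqI)
    fix j
    show "Poly_Mapping.lookup (weyl_contr_mono n a b k + s) j = Poly_Mapping.lookup (a + b) j"
      using le[of j] unfolding weyl_contr_mono_def s_def[symmetric]
      by (simp add: lookup_add lookup_minus)
  qed
  moreover have "monom_deg s = 2 * sum k {..<n}"
    by (simp add: s_def monom_deg_sum monom_deg_add sum_distrib_left mult_2)
  ultimately show ?thesis
    by (metis monom_deg_add)
qed

lemma lookup_weyl_mult:
  "Poly_Mapping.lookup (weyl_mult n p q) m =
     (\<Sum>a\<in>Poly_Mapping.keys p. \<Sum>b\<in>Poly_Mapping.keys q. \<Sum>k\<in>weyl_contr_set n a b.
        (Poly_Mapping.lookup p a * Poly_Mapping.lookup q b * of_int (weyl_contr_coeff n a b k)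
            when weyl_contr_mono n a b k = m))"
  by (simp add: weyl_mult_def weyl_mono_mult_def lookup_sum lookup_single)

text \<open>Cancellation can only remove monomials, so each one left comes from a nonzero term of
  the expansion.\<close>

lemma keys_weyl_multE:
  assumes "m \<in> Poly_Mapping.keys (weyl_mult n p q)"
  obtains a b k where "a \<in> Poly_Mapping.keys p" "b \<in> Poly_Mapping.keys q" "k \<in> weyl_contr_set n a b"
    "m = weyl_contr_mono n a b k"
proof -
  have "Poly_Mapping.lookup (weyl_mult n p q) m \<noteq> 0" using assms by (simp add: in_keys_iff)
  then obtain a where "a \<in> Poly_Mapping.keys p"
      and a: "(\<Sum>b\<in>Poly_Mapping.keys q. \<Sum>k\<in>weyl_contr_set n a b.
        (Poly_Mapping.lookup p a * Poly_Mapping.lookup q b * of_int (weyl_contr_coeff n a b k)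
            when weyl_contr_mono n a b k = m)) \<noteq> 0"
    unfolding lookup_weyl_mult by (rule sum.not_neutral_contains_not_neutral)
  from a obtain b where "b \<in> Poly_Mapping.keys q" and b: "(\<Sum>k\<in>weyl_contr_set n a b.
        (Poly_Mapping.lookup p a * Poly_Mapping.lookup q b * of_int (weyl_contr_coeff n a b k)
            when weyl_contr_mono n a b k = m)) \<noteq> 0"
    by (rule sum.not_neutral_contains_not_neutral)
  from b obtain k where "k \<in> weyl_contr_set n a b"
    and "(Poly_Mapping.lookup p a * Poly_Mapping.lookup q b * of_int (weyl_contr_coeff n a b k)
        when weyl_contr_mono n a b k = m) \<noteq> 0"
    by (rule sum.not_neutral_contains_not_neutral)
  with \<open>a \<in> Poly_Mapping.keys p\<close> \<open>b \<in> Poly_Mapping.keys q\<close> show thesis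
    by (intro that[of a b k]) (auto simp: when_def split: if_splits)
qed

lemma weyl_mult_closed:
  assumes "p \<in> weyl_carrier n" "q \<in> weyl_carrier n"
  shows "weyl_mult n p q \<in> weyl_carrier n"
  unfolding weyl_carrier_def
proof (intro CollectI ballI)
  fix m assume "m \<in> Poly_Mapping.keys (weyl_mult n p q)"
  then obtain a b k where "a \<in> Poly_Mapping.keys p" "b \<in> Poly_Mapping.keys q" and
      m: "m = weyl_contr_mono n a b k"
    by (rule keys_weyl_multE)
  then show "Poly_Mapping.keys m \<subseteq> {..<2 * n}"
    using assms keys_weyl_contr_mono[of n a b k] by (fastforce simp: weyl_carrier_def)
qed

section \<open>Degree bounds and leading monomials\<close>

text \<open>A predicate rather than an inequality on \<open>weyl_deg\<close>, because the latter is
  a maximum over the empty set at zero, whereas zero satisfies every bound here.\<close>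

definition deg_le :: "'a::zero weyl \<Rightarrow> nat \<Rightarrow> bool" where
  "deg_le p d \<longleftrightarrow> (\<forall>m\<in>Poly_Mapping.keys p. monom_deg m \<le> d)"

lemma deg_le_weyl_mult:
  assumes "deg_le p d" "deg_le q e"
  shows "deg_le (weyl_mult n p q) (d + e)"
  unfolding deg_le_def
proof
  fix m assume "m \<in> Poly_Mapping.keys (weyl_mult n p q)"
  then obtain a b k where "a \<in> Poly_Mapping.keys p" "b \<in> Poly_Mapping.keys q" "k \<in> weyl_contr_set n a b"
    and m: "m = weyl_contr_mono n a b k"
    by (rule keys_weyl_multE)
  moreover have "monom_deg m \<le> monom_deg a + monom_deg b"
    using monom_deg_weyl_contr_mono[OF \<open>k \<in> _\<close>] by (simp add: m monom_deg_add)
  ultimately show "monom_deg m \<le> d + e"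
    using assms by (force simp: deg_le_def)
qed

lemma deg_le_weyl_deg: "deg_le p (weyl_deg p)"
  by (auto simp: deg_le_def weyl_deg_def monom_deg_def intro!: Max_ge)

text \<open>On monomials, \<open>\<le>\<close> is the lexicographic order, so this is the graded lexicographic order.\<close>

definition is_lead :: "'a::zero weyl \<Rightarrow> (nat \<Rightarrow>\<^sub>0 nat) \<Rightarrow> bool" where
  "is_lead p g \<longleftrightarrow> g \<in> Poly_Mapping.keys p \<and>
     (\<forall>m\<in>Poly_Mapping.keys p. monom_deg m < monom_deg g \<or>
       (monom_deg m = monom_deg g \<and> m \<le> g))"

text \<open>The order on monomials is linear, so the finitely many monomials of top degree have a
  largest one.\<close>

lemma exists_is_lead:
  assumes "p \<noteq> 0"
  shows "\<exists>g. is_lead p g \<and> monom_deg g = weyl_deg p"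
proof -
  have ne: "Poly_Mapping.keys p \<noteq> {}" using assms
    by (metis keys_eq_empty)
  let ?K = "{m \<in> Poly_Mapping.keys p. monom_deg m = weyl_deg p}"
  have "weyl_deg p \<in> (monom_deg ` Poly_Mapping.keys p)"
    unfolding weyl_deg_def monom_deg_def using ne by (intro Max_in) auto
  then have K: "?K \<noteq> {}" by auto
  have "Max ?K \<in> ?K" using K by (intro Max_in) auto
  moreover have "monom_deg m < weyl_deg p \<or> (monom_deg m = weyl_deg p \<and> m \<le> Max ?K)"
    if "m \<in> Poly_Mapping.keys p" for m
    using deg_le_weyl_deg[of p] that by (auto simp: deg_le_def order_less_le intro!: Max_ge)
  ultimately show ?thesis unfolding is_lead_def by (intro exI[of _ "Max ?K"]) auto
qed

text \<open>A term contributing to \<open>g + h\<close> must have top degree in both factors and no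
  contraction. Strict monotonicity of addition for the lexicographic order then leaves only the pair
  \<open>g\<close>, \<open>h\<close>. In a domain the coefficient is therefore nonzero.\<close>

lemma lookup_weyl_mult_lead:
  assumes p: "is_lead p g" and q: "is_lead q h"
  shows "Poly_Mapping.lookup (weyl_mult n p q) (g + h) = Poly_Mapping.lookup p g * Poly_Mapping.lookup q h"
proof -
  let ?t = "\<lambda>a b k. (Poly_Mapping.lookup p a * Poly_Mapping.lookup q b * of_int (weyl_contr_coeff n a b k)
     when weyl_contr_mono n a b k = g + h)"
  have key: "?t a b k = (if k = (\<lambda>_. 0) then if b = h then
        if a = g then Poly_Mapping.lookup p g * Poly_Mapping.lookup q h else 0 else 0 else 0)"
    if "a \<in> Poly_Mapping.keys p" "b \<in> Poly_Mapping.keys q" "k \<in> weyl_contr_set n a b" for a b k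
  proof (cases "weyl_contr_mono n a b k = g + h")
    case True
    have a: "monom_deg a < monom_deg g \<or> (monom_deg a = monom_deg g \<and> a \<le> g)"
      and b: "monom_deg b < monom_deg h \<or> (monom_deg b = monom_deg h \<and> b \<le> h)"
      using p q that unfolding is_lead_def by auto
    have "monom_deg g + monom_deg h + 2 * sum k {..<n} = monom_deg a + monom_deg b"
      using monom_deg_weyl_contr_mono[OF that(3)] True by (simp add: monom_deg_add)
    then have eq: "monom_deg a = monom_deg g" "monom_deg b = monom_deg h" "sum k {..<n} = 0"
      using a b by linarith+
    have k0: "k = (\<lambda>_. 0)"
    proof
      fix i show "k i = 0"
        using eq(3) that(3) by (cases "i < n") (auto simp: weyl_contr_set_def)
    qed
    have "a + b = g + h" using True by (simp add: k0 weyl_contr_mono_zero)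
    moreover have "a \<le> g" "b \<le> h" using a b eq by auto
    ultimately have "a = g" "b = h"
      by (metis add_le_less_mono add_less_le_mono order.strict_iff_order)+
    then show ?thesis
      by (simp add: k0 weyl_contr_mono_zero weyl_contr_coeff_zero)
  next
    case False
    then show ?thesis by (auto simp: weyl_contr_mono_zero)
  qed
  have "Poly_Mapping.lookup (weyl_mult n p q) (g + h) =
      (\<Sum>a\<in>Poly_Mapping.keys p. \<Sum>b\<in>Poly_Mapping.keys q. \<Sum>k\<in>weyl_contr_set n a b.
      (if k = (\<lambda>_. 0) then if b = h then
        if a = g then Poly_Mapping.lookup p g * Poly_Mapping.lookup q h else 0 else 0 else 0))"
    unfolding lookup_weyl_mult by (intro sum.cong refl key)
  also have "\<dots> = (\<Sum>a\<in>Poly_Mapping.keys p. \<Sum>b\<in>Poly_Mapping.keys q. if b = h then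
        if a = g then Poly_Mapping.lookup p g * Poly_Mapping.lookup q h else 0 else 0)"
    by (simp add: finite_weyl_contr_set zero_in_weyl_contr_set)
  also have "\<dots> = Poly_Mapping.lookup p g * Poly_Mapping.lookup q h"
    using p q by (simp add: is_lead_def)
  finally show ?thesis .
qed

section \<open>Division by a generator\<close>

text \<open>Division by a generator is exact on the side on which normal ordering places it, because no
  contraction occurs there.\<close>

lemma weyl_contr_set_left_gen:
  assumes "j < n"
  shows "weyl_contr_set n (Poly_Mapping.single j 1) b = {\<lambda>_. 0}"
  using assms by (auto simp: weyl_contr_set_def lookup_single when_def) (metis leI)

lemma weyl_contr_set_right_gen:
  assumes "n \<le> j"
  shows "weyl_contr_set n a (Poly_Mapping.single j 1) = {\<lambda>_. 0}"
  using assms by (auto simp: weyl_contr_set_def lookup_single when_def) (metis leI)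

lemma weyl_mult_gen_left:
  assumes "j < n"
  shows "weyl_mult n (weyl_gen j) p = (\<Sum>b\<in>Poly_Mapping.keys p. Poly_Mapping.single (Poly_Mapping.single j 1 + b) (Poly_Mapping.lookup p b))"
  using assms unfolding weyl_mult_def weyl_mono_mult_def weyl_gen_def
  by (simp add: weyl_contr_set_left_gen[simplified] weyl_contr_mono_zero weyl_contr_coeff_zero)

lemma weyl_mult_gen_right:
  assumes "n \<le> j"
  shows "weyl_mult n p (weyl_gen j) = (\<Sum>b\<in>Poly_Mapping.keys p. Poly_Mapping.single (Poly_Mapping.single j 1 + b) (Poly_Mapping.lookup p b))"
  using assms unfolding weyl_mult_def weyl_mono_mult_def weyl_gen_def
  by (simp add: weyl_contr_set_right_gen[simplified] weyl_contr_mono_zero weyl_contr_coeff_zero add.commute)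

text \<open>Every monomial lies in the range of the injective shift by
  \<open>Poly_Mapping.single j 1\<close>, so reading coefficients through the shift loses nothing.
  The sum has the shape of both \<open>weyl_mult_gen_left\<close> and
  \<open>weyl_mult_gen_right\<close>, so one quotient serves both sides.\<close>

lemma exists_exponent_shift:
  assumes "p \<in> weyl_carrier n" "\<forall>m\<in>Poly_Mapping.keys p. Poly_Mapping.lookup m j \<noteq> 0"
  shows "\<exists>q\<in>weyl_carrier n. p =
      (\<Sum>b\<in>Poly_Mapping.keys q. Poly_Mapping.single (Poly_Mapping.single j 1 + b) (Poly_Mapping.lookup q b))"
proof
  let ?s = "\<lambda>b. Poly_Mapping.single j 1 + b :: nat \<Rightarrow>\<^sub>0 nat"
  let ?q = "Poly_Mapping.map_key ?s p"
  have inj: "inj ?s" by (auto intro: injI)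
  have keys_p: "Poly_Mapping.keys p = ?s ` Poly_Mapping.keys ?q"
  proof (intro equalityI subsetI)
    fix m assume m: "m \<in> Poly_Mapping.keys p"
    have "m = ?s (m - Poly_Mapping.single j 1)"
      using assms(2) m by (intro poly_mapping_eqI) (auto simp: lookup_add lookup_minus lookup_single when_def)
    then show "m \<in> ?s ` Poly_Mapping.keys ?q"
      using m inj by (auto simp: keys_map_key)
  qed (auto simp: keys_map_key[OF inj, simplified])
  show "?q \<in> weyl_carrier n"
    unfolding weyl_carrier_def
  proof (intro CollectI ballI)
    fix b assume "b \<in> Poly_Mapping.keys ?q"
    then have "Poly_Mapping.keys (?s b) \<subseteq> {..<2 * n}"
      using keys_p assms(1) by (auto simp: weyl_carrier_def)
    moreover have "Poly_Mapping.keys b \<subseteq> Poly_Mapping.keys (?s b)" by (auto simp: in_keys_iff lookup_add)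
    ultimately show "Poly_Mapping.keys b \<subseteq> {..<2 * n}" by blast
  qed
  have "(\<Sum>b\<in>Poly_Mapping.keys ?q. Poly_Mapping.single (?s b) (Poly_Mapping.lookup ?q b)) =
      (\<Sum>m\<in>Poly_Mapping.keys p. Poly_Mapping.single m (Poly_Mapping.lookup p m))"
    unfolding keys_p by (subst sum.reindex) (auto simp: map_key.rep_eq inj)
  also have "\<dots> = p"
    by (rule poly_mapping_eqI) (auto simp: lookup_sum lookup_single when_def in_keys_iff)
  finally show "p = (\<Sum>b\<in>Poly_Mapping.keys ?q. Poly_Mapping.single (?s b) (Poly_Mapping.lookup ?q b))" ..
qed

lemma weyl_mult_zero_left [simp]: "weyl_mult n 0 q = 0"
  and weyl_mult_zero_right [simp]: "weyl_mult n p 0 = 0"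
  by (simp_all add: weyl_mult_def)

lemma lookup_weyl_smult: "Poly_Mapping.lookup (weyl_smult r p) m = r * Poly_Mapping.lookup p m"
  by (simp add: weyl_smult_def map.rep_eq when_def)

lemma weyl_smult_single_one: "weyl_smult r (Poly_Mapping.single m 1) = Poly_Mapping.single m r"
  by (rule poly_mapping_eqI) (simp add: lookup_weyl_smult lookup_single when_def)

lemma weyl_gen_in_carrier: "j < 2 * n \<Longrightarrow> weyl_gen j \<in> weyl_carrier n"
  by (auto simp: weyl_gen_def weyl_carrier_def)

lemma single_in_weyl_carrier: "Poly_Mapping.keys m \<subseteq> {..<2 * n}
    \<Longrightarrow> Poly_Mapping.single m c \<in> weyl_carrier n"
  by (auto simp: weyl_carrier_def)

lemma zero_in_weyl_carrier: "0 \<in> weyl_carrier n"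
  by (simp add: weyl_carrier_def)

lemma sum_in_weyl_carrier: "(\<And>s. s \<in> S \<Longrightarrow> f s \<in> weyl_carrier n)
    \<Longrightarrow> sum f S \<in> weyl_carrier n"
  unfolding weyl_carrier_def using Poly_Mapping.keys_sum[of f S] by blast

section \<open>Automorphisms and the degree filtration\<close>

context
  fixes n :: nat and \<phi> :: "'a::idom weyl \<Rightarrow> 'a weyl"
  assumes aut: "weyl_automorphism n \<phi>"
begin

lemma image_in_carrier: "p \<in> weyl_carrier n \<Longrightarrow> \<phi> p \<in> weyl_carrier n"
  using aut unfolding weyl_automorphism_def by (blast dest: bij_betwE)

lemma inj_on_carrier: "inj_on \<phi> (weyl_carrier n)"
  using aut unfolding weyl_automorphism_def by (blast dest: bij_betw_imp_inj_on)

lemma image_surj: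
  assumes "q \<in> weyl_carrier n"
  obtains p where "p \<in> weyl_carrier n" "\<phi> p = q"
proof -
  have "\<phi> ` weyl_carrier n = weyl_carrier n"
    using aut unfolding weyl_automorphism_def by (blast dest: bij_betw_imp_surj_on)
  with assms have "q \<in> \<phi> ` weyl_carrier n" by simp
  then show thesis using that by (auto elim: imageE)
qed

lemma image_add: "p \<in> weyl_carrier n \<Longrightarrow> q
    \<in> weyl_carrier n \<Longrightarrow> \<phi> (p + q) = \<phi> p + \<phi> q"
  and image_smult: "p \<in> weyl_carrier n \<Longrightarrow> \<phi> (weyl_smult r p) = weyl_smult r (\<phi> p)"
  and image_mult: "p \<in> weyl_carrier n \<Longrightarrow> q
      \<in> weyl_carrier n \<Longrightarrow> \<phi> (weyl_mult n p q) = weyl_mult n (\<phi> p) (\<phi> q)"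
  and image_one: "\<phi> weyl_one = weyl_one"
  using aut unfolding weyl_automorphism_def by blast+

lemma image_zero: "\<phi> 0 = 0"
  using image_add[OF zero_in_weyl_carrier zero_in_weyl_carrier]
  by (metis add_0 add_cancel_right_right)

lemma image_sum:
  assumes "\<And>s. s \<in> S \<Longrightarrow> f s \<in> weyl_carrier n"
  shows "\<phi> (sum f S) = (\<Sum>s\<in>S. \<phi> (f s))"
  using assms
proof (induction S rule: infinite_finite_induct)
  case (insert x S)
  have "f x \<in> weyl_carrier n" "sum f S \<in> weyl_carrier n"
    using insert.prems by (auto intro: sum_in_weyl_carrier)
  then show ?case using insert by (simp add: image_add)
qed (simp_all add: image_zero)

text \<open>Splitting off one generator at a time turns the monomial into a product, and each
  factor's image adds at most \<open>weyl_map_deg n \<phi>\<close> to the degree.\<close>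

lemma deg_le_image_monom:
  assumes "Poly_Mapping.keys m \<subseteq> {..<2 * n}"
  shows "deg_le (\<phi> (Poly_Mapping.single m 1)) (weyl_map_deg n \<phi> * monom_deg m)"
  using assms
proof (induction "monom_deg m" arbitrary: m)
  case 0
  then have "m = 0"
    by (intro poly_mapping_eqI) (auto simp: monom_deg_def in_keys_iff)
  then show ?case using image_one by (simp add: weyl_one_def deg_le_def)
next
  case (Suc e)
  then have "Poly_Mapping.keys m \<noteq> {}" by (auto simp: monom_deg_def)
  then obtain j where j: "j \<in> Poly_Mapping.keys m" by blast
  with Suc.prems have j2: "j < 2 * n" by auto
  define m' where "m' = m - Poly_Mapping.single j 1"
  have m: "m = Poly_Mapping.single j 1 + m'"
    using j by (intro poly_mapping_eqI)
      (auto simp: m'_def lookup_add lookup_minus lookup_single when_def in_keys_iff)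
  have keys_g: "Poly_Mapping.keys m' \<subseteq> {..<2 * n}"
  proof
    fix x assume "x \<in> Poly_Mapping.keys m'"
    then have "x \<in> Poly_Mapping.keys m" unfolding in_keys_iff m'_def lookup_minus by simp
    then show "x \<in> {..<2 * n}" using Suc.prems by blast
  qed
  have deg_m: "monom_deg m = Suc (monom_deg m')"
    unfolding m by (simp add: monom_deg_add)
  let ?y = "Poly_Mapping.single m' 1 :: 'a weyl"
  have c: "weyl_gen j \<in> weyl_carrier n" "?y \<in> weyl_carrier n"
    using weyl_gen_in_carrier single_in_weyl_carrier j2 keys_g by blast+
  have "weyl_deg (\<phi> (weyl_gen j)) \<le> weyl_map_deg n \<phi>"
    unfolding weyl_map_deg_def using j2 by (intro Max_ge) auto
  then have gen: "deg_le (\<phi> (weyl_gen j)) (weyl_map_deg n \<phi>)"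
    using deg_le_weyl_deg[of "\<phi> (weyl_gen j)"] by (force simp: deg_le_def)
  have rest: "deg_le (\<phi> ?y) (weyl_map_deg n \<phi> * monom_deg m')"
    by (rule Suc.hyps(1)) (use Suc.hyps(2) deg_m keys_g in simp_all)
  \<comment> \<open>Derivations are split off on the left and variables on the right, so that the
    factorisation is free of contraction terms.\<close>
  show ?case
  proof (cases "j < n")
    case True
    have "Poly_Mapping.single m 1 = weyl_mult n (weyl_gen j) ?y"
      unfolding m by (simp add: weyl_mult_gen_left[OF True])
    then have "\<phi> (Poly_Mapping.single m 1) = weyl_mult n (\<phi> (weyl_gen j)) (\<phi> ?y)"
      by (simp only: image_mult[OF c])
    then show ?thesis
      using deg_le_weyl_mult[OF gen rest, of n] by (simp only: deg_m mult_Suc_right)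
  next
    case False
    then have "Poly_Mapping.single m 1 = weyl_mult n ?y (weyl_gen j)"
      unfolding m by (simp add: weyl_mult_gen_right)
    then have "\<phi> (Poly_Mapping.single m 1) = weyl_mult n (\<phi> ?y) (\<phi> (weyl_gen j))"
      by (simp only: image_mult[OF c(2,1)])
    then show ?thesis
      using deg_le_weyl_mult[OF rest gen, of n] by (simp only: deg_m mult_Suc_right add.commute)
  qed
qed

text \<open>The image is a one-sided multiple of the generator; surjectivity pulls back the cofactor
  and injectivity the equation. Which side occurs depends on whether \<open>j < n\<close>, hence the
  disjunction.\<close>

lemma divisible_by_gen:
  assumes "p \<in> weyl_carrier n" "\<forall>m\<in>Poly_Mapping.keys (\<phi> p). Poly_Mapping.lookup m j \<noteq> 0"
    and "G \<in> weyl_carrier n" "\<phi> G = weyl_gen j"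
  obtains q where "q \<in> weyl_carrier n" "p = weyl_mult n G q \<or> p = weyl_mult n q G"
proof -
  obtain r where r: "r \<in> weyl_carrier n"
    "\<phi> p = (\<Sum>b\<in>Poly_Mapping.keys r. Poly_Mapping.single (Poly_Mapping.single j 1 + b) (Poly_Mapping.lookup r b))"
    using exists_exponent_shift[OF image_in_carrier[OF assms(1)] assms(2)] by blast
  obtain q where q: "q \<in> weyl_carrier n" "\<phi> q = r"
    using image_surj r(1) by blast
  have "\<phi> p = \<phi> (weyl_mult n G q) \<or> \<phi> p = \<phi> (weyl_mult n q G)"
    using weyl_mult_gen_left[of j n r] weyl_mult_gen_right[of n j r] r(2) q assms(3,4)
    by (cases "j < n") (auto simp: image_mult)
  then show thesis
    using that[OF q(1)] inj_onD[OF inj_on_carrier] assms(1,3) q(1) weyl_mult_closed by metis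
qed

section \<open>Comparison of ranks in the two quotients\<close>

text \<open>Otherwise some nonzero combination of monomials not divisible by \<open>g\<close> has an
  image supported on multiples of the generator. It is then a one-sided multiple of
  \<open>G\<close>, so its leading monomial is divisible by \<open>g\<close>, a
  contradiction.\<close>

lemma card_nondivisible_monoms_le:
  assumes G: "G \<in> weyl_carrier n" "\<phi> G = weyl_gen j" and g: "is_lead G g"
  shows "card (monoms {..<2 * n} (k + monom_deg g) - (+) g ` monoms {..<2 * n} k) \<le>
    card (monoms ({..<2 * n} - {j}) (weyl_map_deg n \<phi> * (k + monom_deg g)))"
    (is "card ?S \<le> card ?T")
proof (rule ccontr)
  assume "\<not> card ?S \<le> card ?T"
  then obtain c where c: "\<exists>s\<in>?S. c s \<noteq> 0"
    "\<forall>t\<in>?T. (\<Sum>s\<in>?S. c s * Poly_Mapping.lookup (\<phi> (Poly_Mapping.single s 1)) t) = 0"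
    using exists_nontrivial_relation[of ?T ?S "\<lambda>s. Poly_Mapping.lookup (\<phi> (Poly_Mapping.single s 1))"]
    by (auto simp: finite_monoms)
  have S: "Poly_Mapping.keys s \<subseteq> {..<2 * n}" "monom_deg s \<le> k + monom_deg g" if "s \<in> ?S" for s
    using that by (auto simp: monoms_def)
  define a where "a = (\<Sum>s\<in>?S. Poly_Mapping.single s (c s))"
  have a: "a \<in> weyl_carrier n"
    unfolding a_def using S by (intro sum_in_weyl_carrier single_in_weyl_carrier) auto
  have look_a: "Poly_Mapping.lookup a m = (if m \<in> ?S then c m else 0)" for m
    by (simp add: a_def lookup_sum lookup_single when_def finite_monoms)
  have "\<phi> a = (\<Sum>s\<in>?S. \<phi> (Poly_Mapping.single s (c s)))"
    unfolding a_def using S by (intro image_sum single_in_weyl_carrier) auto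
  also have "\<dots> = (\<Sum>s\<in>?S. weyl_smult (c s) (\<phi> (Poly_Mapping.single s 1)))"
  proof (rule sum.cong)
    fix s assume "s \<in> ?S"
    then show "\<phi> (Poly_Mapping.single s (c s)) = weyl_smult (c s) (\<phi> (Poly_Mapping.single s 1))"
      using S(1) image_smult[OF single_in_weyl_carrier, of s "c s" 1]
      by (simp add: weyl_smult_single_one)
  qed simp
  finally have look: "Poly_Mapping.lookup (\<phi> a) m =
      (\<Sum>s\<in>?S. c s * Poly_Mapping.lookup (\<phi> (Poly_Mapping.single s 1)) m)" for m
    by (simp add: lookup_sum lookup_weyl_smult)
  \<comment> \<open>The degree bound on images puts every monomial of \<open>\<phi> a\<close> free
    of index \<open>j\<close> into \<open>?T\<close>, where the relation makes the coefficient
    vanish.\<close>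
  have "\<forall>m\<in>Poly_Mapping.keys (\<phi> a). Poly_Mapping.lookup m j \<noteq> 0"
  proof
    fix m assume m: "m \<in> Poly_Mapping.keys (\<phi> a)"
    then have ne: "(\<Sum>s\<in>?S. c s * Poly_Mapping.lookup (\<phi> (Poly_Mapping.single s 1)) m) \<noteq> 0"
      by (simp add: in_keys_iff look)
    then obtain s where s: "s \<in> ?S" "c s * Poly_Mapping.lookup (\<phi> (Poly_Mapping.single s 1)) m \<noteq> 0"
      by (rule sum.not_neutral_contains_not_neutral)
    then have "monom_deg m \<le> weyl_map_deg n \<phi> * monom_deg s"
      using deg_le_image_monom[OF S(1)[OF s(1)]] by (auto simp: deg_le_def in_keys_iff)
    also have "\<dots> \<le> weyl_map_deg n \<phi> * (k + monom_deg g)"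
      using S(2)[OF s(1)] by (rule mult_le_mono2)
    finally have deg: "monom_deg m \<le> weyl_map_deg n \<phi> * (k + monom_deg g)" .
    have "Poly_Mapping.keys m \<subseteq> {..<2 * n}"
      using image_in_carrier[OF a] m by (auto simp: weyl_carrier_def)
    then show "Poly_Mapping.lookup m j \<noteq> 0"
      using c(2) ne deg by (auto simp: monoms_def in_keys_iff)
  qed
  then obtain q where q: "q \<in> weyl_carrier n" "a = weyl_mult n G q \<or> a = weyl_mult n q G"
    using divisible_by_gen[OF a _ G] by blast
  have "a \<noteq> 0"
    using c(1) look_a by (metis lookup_zero)
  then have "q \<noteq> 0" using q(2) by auto
  then obtain h where h: "is_lead q h" using exists_is_lead by blast
  have "Poly_Mapping.lookup G g \<noteq> 0" "h \<in> Poly_Mapping.keys q" "Poly_Mapping.lookup q h \<noteq> 0"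
    using g h unfolding is_lead_def in_keys_iff by blast+
  \<comment> \<open>The leading coefficient is the same product for either order of the factors, so
    both cases of the disjunction are covered.\<close>
  then have "Poly_Mapping.lookup a (g + h) \<noteq> 0"
    using q(2) lookup_weyl_mult_lead[OF g h, of n] lookup_weyl_mult_lead[OF h g, of n]
    by (metis add.commute mult_eq_0_iff)
  then have gh: "g + h \<in> ?S"
    using look_a[of "g + h"] by metis
  \<comment> \<open>Cancelling \<open>monom_deg g\<close> in the degree bound for
    \<open>g + h\<close> places \<open>g + h\<close> in the very set removed from
    \<open>?S\<close>.\<close>
  moreover have "h \<in> monoms {..<2 * n} k"
    using S(2)[OF gh] q(1) \<open>h \<in> Poly_Mapping.keys q\<close>
    by (simp add: monoms_def monom_deg_add weyl_carrier_def)
  ultimately show False by blast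
qed

text \<open>The rank comparison holds for every \<open>k\<close>; evaluating both counts by binomial
  coefficients gives the hypothesis of \<open>le_power_of_binomial_growth\<close>.\<close>

lemma weyl_deg_preimage_gen:
  assumes G: "G \<in> weyl_carrier n" "\<phi> G = weyl_gen j" and j: "j < 2 * n"
  shows "weyl_deg G \<le> weyl_map_deg n \<phi> ^ (2 * n - 1)"
proof -
  have "Poly_Mapping.lookup (weyl_gen j :: 'a weyl) (Poly_Mapping.single j 1) \<noteq> 0"
    by (simp add: weyl_gen_def)
  then have "G \<noteq> 0"
    using G(2) image_zero by (metis lookup_zero)
  then obtain g where g: "is_lead G g" and D: "monom_deg g = weyl_deg G"
    using exists_is_lead by blast
  have keys_g: "Poly_Mapping.keys g \<subseteq> {..<2 * n}"
    using g G(1) unfolding is_lead_def weyl_carrier_def by blast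
  define r where "r = 2 * n - 1"
  have N: "2 * n = Suc r" using j by (simp add: r_def)
  have "weyl_deg G * ((k + r) choose r) \<le>
      (weyl_map_deg n \<phi> * (k + weyl_deg G) + r) choose r" for k
  proof -
    let ?M = "monoms {..<2 * n} (k + weyl_deg G)" and ?I = "(+) g ` monoms {..<2 * n} k"
    have "?I \<subseteq> ?M"
    proof (rule image_subsetI)
      fix m assume "m \<in> monoms {..<2 * n} k"
      then show "g + m \<in> ?M"
        using keys_g Poly_Mapping.keys_add[of g m] by (simp add: monoms_def monom_deg_add D) blast
    qed
    then have "card (?M - ?I) = ((k + weyl_deg G + Suc r) choose Suc r) - ((k + Suc r) choose Suc r)"
      by (subst card_Diff_subset) (simp_all add: finite_monoms card_monoms card_image N)
    \<comment> \<open>The lower bound from \<open>binomial_gap\<close> is weakened to the shape the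
      growth lemma expects; the growth in \<open>k\<close> to leading order is unaffected.\<close>
    moreover have "weyl_deg G * ((k + r) choose r) \<le> weyl_deg G * ((k + Suc r) choose r)"
      by (intro mult_le_mono2 binomial_right_mono) simp
    ultimately have "weyl_deg G * ((k + r) choose r) \<le> card (?M - ?I)"
      using binomial_gap[of "weyl_deg G" k r] by linarith
    also have "\<dots> \<le> card (monoms ({..<2 * n} - {j}) (weyl_map_deg n \<phi> * (k + weyl_deg G)))"
      using card_nondivisible_monoms_le[OF G g, of k] by (simp only: D)
    \<comment> \<open>Without \<open>j\<close> there remain \<open>r\<close> indices, one fewer than
      in the source; this is where the exponent \<open>2 * n - 1\<close> arises.\<close>
    also have "\<dots> = (weyl_map_deg n \<phi> * (k + weyl_deg G) + r) choose r"
      using j N by (simp add: card_monoms)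
    finally show ?thesis .
  qed
  then show ?thesis
    unfolding r_def[symmetric] by (rule le_power_of_binomial_growth)
qed

end

theorem theorem2:
  fixes \<phi> :: "'a::idom weyl \<Rightarrow> 'a weyl" and n :: nat
  assumes "n \<ge> 1"
    and "weyl_automorphism n \<phi>"
  shows "weyl_map_deg n (the_inv_into (weyl_carrier n) \<phi>) \<le> weyl_map_deg n \<phi> ^ (2*n - 1)"
proof -
  have "weyl_deg (the_inv_into (weyl_carrier n) \<phi> (weyl_gen j)) \<le> weyl_map_deg n \<phi> ^ (2*n - 1)"
    if j: "j < 2 * n" for j
  proof -
    obtain G where G: "G \<in> weyl_carrier n" "\<phi> G = weyl_gen j"
      using image_surj[OF assms(2) weyl_gen_in_carrier[OF j]] by blast
    then have "the_inv_into (weyl_carrier n) \<phi> (weyl_gen j) = G"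
      using the_inv_into_f_f[OF inj_on_carrier[OF assms(2)] G(1)] by simp
    then show ?thesis
      using weyl_deg_preimage_gen[OF assms(2) G j] by simp
  qed
  \<comment> \<open>As \<open>n\<close> is positive, the maximum ranges over a nonempty set and is
    bounded by a common bound of its members.\<close>
  then show ?thesis
    unfolding weyl_map_deg_def[of n "the_inv_into (weyl_carrier n) \<phi>"]
    using assms(1) by (intro Max.boundedI) (auto simp: lessThan_empty_iff)
qed

end
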